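(* Let $A\in\mathbb{R}\setminus\{0\}$ and $B,a_0,b_0\in\mathbb{R}$ with $a_0+b_0=B$, and put $a(\epsilon)=a_0+\frac{A}{\epsilon}$, $b(\epsilon)=b_0-\frac{A}{\epsilon}$ for $\epsilon\in(0,1]$; assume $b(\epsilon)\neq0$ for all $\epsilon\in(0,1]$. Then $\eta^{A,B}$ is the strong contraction of the family of representations $\{\rho_\epsilon^{a(\epsilon),b(\epsilon)}\}_{\epsilon\in(0,1]}$ in the following sense: 1. (Pointwise convergence) for any $f\in L^2(\mathbb{R})$, any $x\in\mathbb{R}$ and any $g\in H$, $$\lim_{\epsilon\to0^+}\big(\rho_\epsilon^{a(\epsilon),b(\epsilon)}(P_\epsilon(g))f\big)(x)=\big(\eta^{A,B}(g)f\big)(x);$$ 2. (Norm convergence) for any $f\in L^2(\mathbb{R})$ and any $g\in H$, $\lim_{\epsilon\to0^+}\rho_\epsilon^{a(\epsilon),b(\epsilon)}(P_\epsilon(g))f=\eta^{A,B}(g)f$ in $L^2(\mathbb{R})$.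
   Context: Heisenberg group $H$: the set $\mathbb{R}\times\mathbb{R}^2$ with product $(x_1,(y_1,z_1))(x_2,(y_2,z_2))=(x_1+x_2,\,(y_1+y_2+x_1z_2,\ z_1+z_2))$. Extended affine group $EA$: the set $\mathbb{R}^+\times\mathbb{R}\times\mathbb{R}$ with product $(\alpha,\beta,\gamma)(x,y,z)=(\alpha x,\alpha y+\beta,\gamma+z)$. For $A\ne0$, $B\in\mathbb{R}$, $\eta^{A,B}$ is the unitary representation of $H$ on $L^2(\mathbb{R})$ given by $(\eta^{A,B}(c,(v_1,v_2))f)(x)=e^{i[A(v_1+xv_2)+Bv_2]}f(c+x)$. For $\epsilon\in(0,1]$, $a\in\mathbb{R}$, $b\in\mathbb{R}\setminus\{0\}$, $\rho_\epsilon^{a,b}$ is the unitary representation of $EA$ on $L^2(\mathbb{R})$ given by $(\rho_\epsilon^{a,b}(\alpha,\beta,\gamma)f)(x)=e^{ia\gamma}e^{ib\beta e^{-\epsilon x}}f\big(x-\tfrac{\log\alpha}{\epsilon}\big)$. $P_\epsilon:H\to EA$ is $P_\epsilon(x,(y,z))=\big(e^{-\epsilon x},\ z\tfrac{e^{-\epsilon x}-1}{-\epsilon x},\ z+\epsilon(y-\tfrac{xz}{2})\big)$, with the fraction read as $1$ when $x=0$. In the pointwise statement, $f$ is a fixed function representing its class and the representations act by the displayed formulas. *)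

theory Defs
  imports "HOL-Analysis.Analysis" "HOL-Algebra.Group"
begin

section \<open>The groups\<close>

definition heisenberg_group :: "(real \<times> real \<times> real) monoid" where
  "heisenberg_group =
     \<lparr>carrier = UNIV,
      mult = (\<lambda>(x1, y1, z1) (x2, y2, z2). (x1 + x2, y1 + y2 + x1 * z2, z1 + z2)),
      one = (0, 0, 0)\<rparr>"

definition extended_affine_group :: "(real \<times> real \<times> real) monoid" where
  "extended_affine_group =
     \<lparr>carrier = {0<..} \<times> UNIV \<times> UNIV,
      mult = (\<lambda>(\<alpha>, \<beta>, \<gamma>) (x, y, z). (\<alpha> * x, \<alpha> * y + \<beta>, \<gamma> + z)),
      one = (1, 0, 0)\<rparr>"

lemma group_heisenberg: "group heisenberg_group"
proof (rule groupI)
  fix g assume "g \<in> carrier heisenberg_group"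
  obtain x y z where g: "g = (x, y, z)" by (cases g)
  show "\<exists>h\<in>carrier heisenberg_group.
          h \<otimes>\<^bsub>heisenberg_group\<^esub> g = \<one>\<^bsub>heisenberg_group\<^esub>"
    by (rule bexI[of _ "(- x, x * z - y, - z)"])
       (auto simp: heisenberg_group_def g algebra_simps)
qed (auto simp: heisenberg_group_def algebra_simps)

lemma group_extended_affine: "group extended_affine_group"
proof (rule groupI)
  fix g assume "g \<in> carrier extended_affine_group"
  then obtain x y z where g: "g = (x, y, z)" and "x > 0"
    by (cases g) (auto simp: extended_affine_group_def)
  then show "\<exists>h\<in>carrier extended_affine_group.
          h \<otimes>\<^bsub>extended_affine_group\<^esub> g = \<one>\<^bsub>extended_affine_group\<^esub>"
    by (intro bexI[of _ "(1 / x, - y / x, - z)"])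
       (auto simp: extended_affine_group_def)
qed (auto simp: extended_affine_group_def algebra_simps)

section \<open>The space of square-integrable functions\<close>

text \<open>
  Elements of the space are represented by functions; two functions represent the same
  element iff they agree almost everywhere, i.e. iff their difference has norm zero.
\<close>

definition L2_space :: "(real \<Rightarrow> complex) set" where
  "L2_space = {f \<in> borel_measurable lebesgue. integrable lebesgue (\<lambda>x. (cmod (f x))\<^sup>2)}"

definition L2_norm :: "(real \<Rightarrow> complex) \<Rightarrow> real" where
  "L2_norm f = sqrt (\<integral>x. (cmod (f x))\<^sup>2 \<partial>lebesgue)"

text \<open>
  Membership is part of convergence, since the Bochner integral of a non-integrable
  function is zero by convention.
\<close>

definition L2_tendsto ::
    "('i \<Rightarrow> real \<Rightarrow> complex) \<Rightarrow> (real \<Rightarrow> complex) \<Rightarrow> 'i filter \<Rightarrow> bool" where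
  "L2_tendsto u f F \<longleftrightarrow>
     f \<in> L2_space \<and> (\<forall>\<^sub>F i in F. u i \<in> L2_space) \<and>
     ((\<lambda>i. L2_norm (\<lambda>x. u i x - f x)) \<longlongrightarrow> 0) F"

section \<open>The representations\<close>

definition eta :: "real \<Rightarrow> real \<Rightarrow> real \<times> real \<times> real \<Rightarrow> (real \<Rightarrow> complex) \<Rightarrow> real \<Rightarrow> complex" where
  "eta A B = (\<lambda>(c, v1, v2) f x. cis (A * (v1 + x * v2) + B * v2) * f (c + x))"

definition rho ::
    "real \<Rightarrow> real \<Rightarrow> real \<Rightarrow> real \<times> real \<times> real \<Rightarrow> (real \<Rightarrow> complex) \<Rightarrow> real \<Rightarrow> complex" where
  "rho \<epsilon> a b = (\<lambda>(\<alpha>, \<beta>, \<gamma>) f x.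
     cis (a * \<gamma>) * cis (b * \<beta> * exp (- \<epsilon> * x)) * f (x - ln \<alpha> / \<epsilon>))"

definition P_map :: "real \<Rightarrow> real \<times> real \<times> real \<Rightarrow> real \<times> real \<times> real" where
  "P_map \<epsilon> = (\<lambda>(x, y, z).
     (exp (- \<epsilon> * x),
      z * (if x = 0 then 1 else (exp (- \<epsilon> * x) - 1) / (- \<epsilon> * x)),
      z + \<epsilon> * (y - x * z / 2)))"

lemma P_map_in_carrier: "P_map \<epsilon> g \<in> carrier extended_affine_group"
  by (auto simp: P_map_def extended_affine_group_def split: prod.splits)

lemma phase_translate_L2:
  assumes f: "f \<in> L2_space" and p: "p \<in> borel_measurable borel" "\<And>x. cmod (p x) = 1"
  shows "(\<lambda>x. p x * f (c + x)) \<in> L2_space"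
    and "L2_norm (\<lambda>x. p x * f (c + x)) = L2_norm f"
proof -
  have t: "(\<lambda>x. c + x) \<in> lebesgue \<rightarrow>\<^sub>M lebesgue"
    using lebesgue_affine_measurable[where c = "\<lambda>_::real. 1" and t = c] by simp
  have "(\<lambda>x. f (c + x)) \<in> borel_measurable lebesgue"
    using measurable_compose[OF t, of f borel] f by (simp add: L2_space_def)
  moreover have "p \<in> borel_measurable lebesgue"
    using p(1) by (simp add: borel_measurable_if_I measurable_completion)
  ultimately have "(\<lambda>x. p x * f (c + x)) \<in> borel_measurable lebesgue"
    by (intro borel_measurable_times)
  moreover have "integrable lebesgue (\<lambda>x. (cmod (f (c + x)))\<^sup>2)"
    using lebesgue_integrable_real_affine[of "\<lambda>x. (cmod (f x))\<^sup>2" 1 c] f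
    by (simp add: L2_space_def)
  ultimately show "(\<lambda>x. p x * f (c + x)) \<in> L2_space"
    by (simp add: L2_space_def norm_mult p(2))
  show "L2_norm (\<lambda>x. p x * f (c + x)) = L2_norm f"
    using lebesgue_integral_real_affine[of 1 "\<lambda>x. (cmod (f x))\<^sup>2" c]
    by (simp add: L2_norm_def norm_mult p(2))
qed

lemma eta_L2:
  assumes "f \<in> L2_space"
  shows "eta A B g f \<in> L2_space" "L2_norm (eta A B g f) = L2_norm f"
proof -
  obtain c v1 v2 where g: "g = (c, v1, v2)" by (cases g)
  have "(\<lambda>x. cis (A * (v1 + x * v2) + B * v2)) \<in> borel_measurable borel"
    by (intro borel_measurable_continuous_onI continuous_intros)
  from phase_translate_L2[OF assms this, of c]
  show "eta A B g f \<in> L2_space" "L2_norm (eta A B g f) = L2_norm f"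
    by (simp_all add: eta_def g)
qed

lemma rho_L2:
  assumes "f \<in> L2_space"
  shows "rho \<epsilon> a b g f \<in> L2_space" "L2_norm (rho \<epsilon> a b g f) = L2_norm f"
proof -
  obtain \<alpha> \<beta> \<gamma> where g: "g = (\<alpha>, \<beta>, \<gamma>)" by (cases g)
  have "(\<lambda>x. cis (a * \<gamma>) * cis (b * \<beta> * exp (- \<epsilon> * x))) \<in> borel_measurable borel"
    by (intro borel_measurable_continuous_onI continuous_intros)
  from phase_translate_L2[OF assms this, of "- (ln \<alpha> / \<epsilon>)"]
  show "rho \<epsilon> a b g f \<in> L2_space" "L2_norm (rho \<epsilon> a b g f) = L2_norm f"
    by (simp_all add: rho_def g norm_mult)
qed

lemma eta_mult: "eta A B (g \<otimes>\<^bsub>heisenberg_group\<^esub> h) f = eta A B g (eta A B h f)"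
proof -
  obtain c v1 v2 d w1 w2 where g: "g = (c, v1, v2)" "h = (d, w1, w2)" by (cases g; cases h)
  have "cis (A * (v1 + w1 + c * w2 + x * (v2 + w2)) + B * (v2 + w2)) =
        cis (A * (v1 + x * v2) + B * v2) * cis (A * (w1 + (c + x) * w2) + B * w2)" for x
    by (simp add: cis_mult algebra_simps)
  then show ?thesis
    by (simp add: eta_def g heisenberg_group_def fun_eq_iff add_ac)
qed

lemma rho_mult:
  assumes "\<epsilon> > 0" "g \<in> carrier extended_affine_group" "h \<in> carrier extended_affine_group"
  shows "rho \<epsilon> a b (g \<otimes>\<^bsub>extended_affine_group\<^esub> h) f = rho \<epsilon> a b g (rho \<epsilon> a b h f)"
proof -
  obtain \<alpha> \<beta> \<gamma> x y z where g: "g = (\<alpha>, \<beta>, \<gamma>)" "h = (x, y, z)" and pos: "\<alpha> > 0" "x > 0"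
    using assms(2,3) by (cases g; cases h) (auto simp: extended_affine_group_def)
  have e: "exp (- \<epsilon> * (t - ln \<alpha> / \<epsilon>)) = \<alpha> * exp (- \<epsilon> * t)" for t
  proof -
    have "- \<epsilon> * (t - ln \<alpha> / \<epsilon>) = ln \<alpha> + - \<epsilon> * t"
      using assms(1) by (simp add: right_diff_distrib)
    then show ?thesis using pos by (simp only: exp_add exp_ln)
  qed
  have s: "t - ln (\<alpha> * x) / \<epsilon> = t - ln \<alpha> / \<epsilon> - ln x / \<epsilon>" for t
    using pos by (simp add: ln_mult add_divide_distrib)
  have p: "cis (a * (\<gamma> + z)) * cis (b * (\<alpha> * y + \<beta>) * q) =
        cis (a * \<gamma>) * cis (b * \<beta> * q) * (cis (a * z) * cis (b * y * (\<alpha> * q)))" for q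
    by (simp add: cis_mult algebra_simps)
  show ?thesis
    unfolding rho_def g extended_affine_group_def
    by (simp only: monoid.simps prod.case fun_eq_iff e s p) (simp only: mult.assoc simp_thms)
qed

end

(* Since ln (exp (- eps * x0)) / eps = - x0, the operator rho o P_eps translates by x0 for every
   eps > 0, exactly as eta does; only the phase depends on eps. In the phase the terms of order
   1/eps cancel because a + b stays bounded, and the first-order Taylor terms of exp give the
   phase of eta. Norm convergence then follows from pointwise convergence by dominated
   convergence, all functions involved having the same modulus |f (x0 + x)|. *)
theory Submission
  imports Defs "HOL-Real_Asymp.Real_Asymp"
begin

text \<open>Dominated convergence for the one-sided filter: the limit inherits the bound by
  \<open>F\<close>, so the squared distance is at most 4 times \<open>(cmod (F x))\<^sup>2\<close>,
  which is integrable.\<close>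

lemma L2_tendsto_at_right_dominated:
  fixes u :: "real \<Rightarrow> real \<Rightarrow> complex"
  assumes F: "F \<in> L2_space" and f: "f \<in> L2_space"
    and u: "\<forall>\<^sub>F s in at_right t. u s \<in> L2_space"
    and bound: "\<forall>\<^sub>F s in at_right t. \<forall>x. cmod (u s x) \<le> cmod (F x)"
    and lim: "\<And>x. ((\<lambda>s. u s x) \<longlongrightarrow> f x) (at_right t)"
  shows "L2_tendsto u f (at_right t)"
proof -
  \<comment> \<open>Both conditions hold on one interval from \<open>t\<close> to \<open>d\<close>.
    A sequence inside it satisfies them at every index, as
    \<open>integral_dominated_convergence\<close> demands, and not only eventually.\<close>
  have "\<forall>\<^sub>F s in at_right t. u s \<in> L2_space \<and> (\<forall>x. cmod (u s x) \<le> cmod (F x))"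
    using u bound by (rule eventually_conj)
  then obtain d where d: "t < d"
    and ev: "\<And>s. t < s \<Longrightarrow> s < d \<Longrightarrow> u s \<in> L2_space \<and> (\<forall>x. cmod (u s x) \<le> cmod (F x))"
    by (auto simp: eventually_at_right_field)
  have f_le: "cmod (f x) \<le> cmod (F x)" for x
  proof (rule tendsto_upperbound[OF tendsto_norm[OF lim]])
    show "\<forall>\<^sub>F s in at_right t. cmod (u s x) \<le> cmod (F x)"
      using bound by eventually_elim auto
  qed simp
  have "((\<lambda>s. \<integral>x. (cmod (u s x - f x))\<^sup>2 \<partial>lebesgue) \<longlongrightarrow> (\<integral>x. 0 \<partial>(lebesgue :: real measure))) (at_right t)"
  proof (rule tendsto_at_right_sequentially[OF d])
    fix S :: "nat \<Rightarrow> real"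
    assume S: "\<And>n. t < S n" "\<And>n. S n < d" "S \<longlonglongrightarrow> t"
    have S': "filterlim S (at_right t) sequentially"
      using S by (intro tendsto_imp_filterlim_at_right) auto
    show "(\<lambda>n. \<integral>x. (cmod (u (S n) x - f x))\<^sup>2 \<partial>lebesgue) \<longlonglongrightarrow> (\<integral>x. 0 \<partial>(lebesgue :: real measure))"
    proof (rule integral_dominated_convergence)
      show "integrable lebesgue (\<lambda>x. 4 * (cmod (F x))\<^sup>2)"
        using F by (simp add: L2_space_def)
      show "(\<lambda>x. (cmod (u (S n) x - f x))\<^sup>2) \<in> borel_measurable lebesgue" for n
      proof -
        have [measurable]: "u (S n) \<in> borel_measurable lebesgue" "f \<in> borel_measurable lebesgue"
          using ev[OF S(1,2)[of n]] f by (simp_all add: L2_space_def)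
        show ?thesis by measurable
      qed
      show "AE x in lebesgue. (\<lambda>n. (cmod (u (S n) x - f x))\<^sup>2) \<longlonglongrightarrow> 0"
      proof (rule AE_I2)
        fix x
        have "(\<lambda>n. u (S n) x) \<longlonglongrightarrow> f x"
          by (rule filterlim_compose[OF lim S'])
        then have "(\<lambda>n. (cmod (u (S n) x - f x))\<^sup>2) \<longlonglongrightarrow> (cmod (f x - f x))\<^sup>2"
          by (intro tendsto_intros)
        then show "(\<lambda>n. (cmod (u (S n) x - f x))\<^sup>2) \<longlonglongrightarrow> 0" by simp
      qed
      show "AE x in lebesgue. norm ((cmod (u (S n) x - f x))\<^sup>2) \<le> 4 * (cmod (F x))\<^sup>2" for n
      proof (rule AE_I2)
        fix x
        have "cmod (u (S n) x) \<le> cmod (F x)"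
          using ev[OF S(1,2)] by blast
        then have "cmod (u (S n) x - f x) \<le> 2 * cmod (F x)"
          using norm_triangle_ineq4[of "u (S n) x" "f x"] f_le[of x] by linarith
        then have "(cmod (u (S n) x - f x))\<^sup>2 \<le> (2 * cmod (F x))\<^sup>2"
          by (intro power_mono) auto
        then show "norm ((cmod (u (S n) x - f x))\<^sup>2) \<le> 4 * (cmod (F x))\<^sup>2"
          by (simp add: power_mult_distrib)
      qed
    qed simp
  qed
  \<comment> \<open>The integral of 0 vanishes and the square root is continuous at 0, so the norms
    follow the squared norms.\<close>
  then have "((\<lambda>s. L2_norm (\<lambda>x. u s x - f x)) \<longlongrightarrow> 0) (at_right t)"
    unfolding L2_norm_def using tendsto_real_sqrt by fastforce
  then show ?thesis
    using f u by (simp add: L2_tendsto_def)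
qed

text \<open>This form puts all dependence on \<open>\<epsilon>\<close> into one real phase. The
  argument of \<open>f\<close> is free of \<open>\<epsilon>\<close>, so the pointwise limit requires
  no continuity of \<open>f\<close>.\<close>

lemma rho_P_map:
  assumes "\<epsilon> \<noteq> 0"
  shows "rho \<epsilon> a b (P_map \<epsilon> (x0, y, z)) f x =
    cis (a * (z + \<epsilon> * (y - x0 * z / 2)) +
         b * (z * (if x0 = 0 then 1 else (exp (- \<epsilon> * x0) - 1) / (- \<epsilon> * x0))) * exp (- \<epsilon> * x))
    * f (x0 + x)"
  using assms by (simp add: rho_def P_map_def cis_mult add.commute)

text \<open>The quotient is 1 - \<open>\<epsilon> * x0 / 2\<close> and
  \<open>exp (- \<epsilon> * x)\<close> is 1 - \<open>\<epsilon> * x\<close>, both up to second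
  order. The terms \<open>A * z / \<epsilon>\<close> cancel; the remaining terms with factor
  \<open>A\<close> are \<open>y - x0 * z / 2\<close> and \<open>z * (x0 / 2 + x)\<close>, with sum
  \<open>y + x * z\<close>. The summand \<open>- x * z / 2\<close> in \<open>P_map\<close> thus
  offsets the first-order term of the quotient.\<close>

lemma contraction_phase_tendsto:
  fixes A a0 b0 x0 x y z :: real
  shows "((\<lambda>\<epsilon>. (a0 + A / \<epsilon>) * (z + \<epsilon> * (y - x0 * z / 2)) +
          (b0 - A / \<epsilon>) * (z * (if x0 = 0 then 1 else (exp (- \<epsilon> * x0) - 1) / (- \<epsilon> * x0)))
            * exp (- \<epsilon> * x))
        \<longlongrightarrow> A * (y + x * z) + (a0 + b0) * z) (at_right 0)"
\<comment> \<open>The split removes the \<open>if\<close>, which leaves one explicit expression in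
  \<open>\<epsilon>\<close> for \<open>real_asymp\<close> to expand.\<close>
proof (cases "x0 = 0")
  case True
  have "((\<lambda>\<epsilon>. (a0 + A / \<epsilon>) * (z + \<epsilon> * y) + (b0 - A / \<epsilon>) * z * exp (- \<epsilon> * x))
        \<longlongrightarrow> A * (y + x * z) + (a0 + b0) * z) (at_right 0)"
    by (real_asymp simp: field_simps)
  with True show ?thesis by simp
next
  case False
  then have "((\<lambda>\<epsilon>. (a0 + A / \<epsilon>) * (z + \<epsilon> * (y - x0 * z / 2)) +
          (b0 - A / \<epsilon>) * (z * ((exp (- \<epsilon> * x0) - 1) / (- \<epsilon> * x0))) * exp (- \<epsilon> * x))
        \<longlongrightarrow> A * (y + x * z) + (a0 + b0) * z) (at_right 0)"
    by (real_asymp simp: field_simps)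
  with False show ?thesis by simp
qed

theorem mainTheorem4:
  fixes A B a0 b0 :: real
    and a b :: "real \<Rightarrow> real"
  assumes "A \<noteq> 0"
    and "a0 + b0 = B"
    and "\<And>\<epsilon>. \<epsilon> \<in> {0<..1} \<Longrightarrow> a \<epsilon> = a0 + A / \<epsilon>"
    and "\<And>\<epsilon>. \<epsilon> \<in> {0<..1} \<Longrightarrow> b \<epsilon> = b0 - A / \<epsilon>"
    and "\<And>\<epsilon>. \<epsilon> \<in> {0<..1} \<Longrightarrow> b \<epsilon> \<noteq> 0"
  shows "(\<forall>f\<in>L2_space. \<forall>x. \<forall>g\<in>carrier heisenberg_group.
            ((\<lambda>\<epsilon>. rho \<epsilon> (a \<epsilon>) (b \<epsilon>) (P_map \<epsilon> g) f x) \<longlongrightarrow> eta A B g f x) (at_right 0)) \<and>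
         (\<forall>f\<in>L2_space. \<forall>g\<in>carrier heisenberg_group.
            L2_tendsto (\<lambda>\<epsilon>. rho \<epsilon> (a \<epsilon>) (b \<epsilon>) (P_map \<epsilon> g) f) (eta A B g f) (at_right 0))"
proof -
  \<comment> \<open>The formulas for \<open>a\<close> and \<open>b\<close> are given only on this
    interval, which is all that the filter sees.\<close>
  have small: "\<forall>\<^sub>F \<epsilon> in at_right (0::real). \<epsilon> \<in> {0<..1}"
    by (auto simp: eventually_at_right_field intro!: exI[of _ 1])
  have lim: "((\<lambda>\<epsilon>. rho \<epsilon> (a \<epsilon>) (b \<epsilon>) (P_map \<epsilon> g) f x) \<longlongrightarrow> eta A B g f x) (at_right 0)"
    for g f x
  proof -
    obtain x0 y z where g: "g = (x0, y, z)" by (cases g)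
    have "((\<lambda>\<epsilon>. cis ((a0 + A / \<epsilon>) * (z + \<epsilon> * (y - x0 * z / 2)) +
          (b0 - A / \<epsilon>) * (z * (if x0 = 0 then 1 else (exp (- \<epsilon> * x0) - 1) / (- \<epsilon> * x0)))
            * exp (- \<epsilon> * x)) * f (x0 + x))
        \<longlongrightarrow> cis (A * (y + x * z) + (a0 + b0) * z) * f (x0 + x)) (at_right 0)"
      unfolding cis_conv_exp
      by (intro tendsto_mult tendsto_exp tendsto_of_real tendsto_const contraction_phase_tendsto)
    moreover have "eta A B g f x = cis (A * (y + x * z) + (a0 + b0) * z) * f (x0 + x)"
      using assms(2) by (simp add: eta_def g)
    moreover have "\<forall>\<^sub>F \<epsilon> in at_right 0. cis ((a0 + A / \<epsilon>) * (z + \<epsilon> * (y - x0 * z / 2)) +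
          (b0 - A / \<epsilon>) * (z * (if x0 = 0 then 1 else (exp (- \<epsilon> * x0) - 1) / (- \<epsilon> * x0)))
            * exp (- \<epsilon> * x)) * f (x0 + x) = rho \<epsilon> (a \<epsilon>) (b \<epsilon>) (P_map \<epsilon> g) f x"
      using small
    proof eventually_elim
      case (elim \<epsilon>)
      then have "\<epsilon> \<noteq> 0" by simp
      from rho_P_map[OF this] show ?case
        by (simp only: g assms(3)[OF elim] assms(4)[OF elim])
    qed
    ultimately show ?thesis
      using tendsto_cong by fastforce
  qed
  \<comment> \<open>The limit \<open>eta A B g f\<close> serves as its own dominating function: unit
    phases and a common translation give equal moduli at every point.\<close>
  have L2_lim: "L2_tendsto (\<lambda>\<epsilon>. rho \<epsilon> (a \<epsilon>) (b \<epsilon>) (P_map \<epsilon> g) f) (eta A B g f) (at_right 0)"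
    if f: "f \<in> L2_space" for g f
  proof (rule L2_tendsto_at_right_dominated[OF eta_L2(1)[OF f] eta_L2(1)[OF f] _ _ lim])
    obtain x0 y z where g: "g = (x0, y, z)" by (cases g)
    show "\<forall>\<^sub>F \<epsilon> in at_right 0. rho \<epsilon> (a \<epsilon>) (b \<epsilon>) (P_map \<epsilon> g) f \<in> L2_space"
      by (simp add: rho_L2(1)[OF f])
    show "\<forall>\<^sub>F \<epsilon> in at_right 0. \<forall>x. cmod (rho \<epsilon> (a \<epsilon>) (b \<epsilon>) (P_map \<epsilon> g) f x) \<le> cmod (eta A B g f x)"
      using small
    proof eventually_elim
      case (elim \<epsilon>)
      then show ?case
        by (simp add: g rho_P_map eta_def norm_mult)
    qed
  qed
  show ?thesis
    using lim L2_lim by blast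
qed

end
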